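(* For all formulas $\phi$ and $\psi$ and every variable $x$, the equations $\{x\mid\phi\vee\psi\}=\{x\mid\phi\}\,\&\,\{x\mid\psi\}$ and $\{x\mid\phi\,\&\,\psi\}=\{x\mid\phi\}\cap\{x\mid\psi\}$ are derivable.
   Context: Formal system. Objects are generated from the constant $\varnothing$ by: $(\alpha)^{\mathsf c}$, $(\alpha)^{\mathsf v}$ (variables are objects of this form), $(\alpha\,\&\,\beta)$ (federation/union/conjunction), $(\alpha\Rightarrow\beta)$ (containment/implication), $(\alpha\cap\beta)$ (intersection), and classes $\{x\mid\beta\}$ ($x$ a variable, which becomes a bound index). $\alpha[x:=\beta]$ replaces every free appearance of $x$ by $\beta$. A formula is an object of the form $\alpha\Rightarrow\beta$. Abbreviations: $\bot:=\varnothing^{\mathsf c}$; $\neg a:=(a\Rightarrow\bot)$; $\bar a:=(\varnothing\Rightarrow a)$; $a\vee b:=\overline{\bar a\cap\bar b}$; $a=b:=(a\Rightarrow b)\&(b\Rightarrow a)$; $a\neq b:=\neg(a=b)$; $\mathrm{Sing}(a):=(\bar a\neq a)\,\&\,((a\Rightarrow b)\Rightarrow(\bar b\vee a=b))$, with $b$ a variable; $a\in b:=\mathrm{Sing}(a)\&(b\Rightarrow a)$; $V:=\{x\mid\varnothing\}$. Rules: R1 from $\alpha$ and $\alpha\Rightarrow\beta$ infer $\beta$; R2 from $\alpha$ infer $\alpha[x:=\beta]$; R3 if $x$ does not appear in $\gamma$, from $\gamma\Rightarrow(\alpha\Rightarrow\beta)$ infer $\gamma\Rightarrow(\{x\mid\beta\}\Rightarrow\{x\mid\alpha\})$.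 Axioms ($a,b,c,d,x$ variables): A1 $((c\Rightarrow a)\&(c\Rightarrow(a\Rightarrow b)))\Rightarrow(c\Rightarrow b)$; A2 $((d\Rightarrow(a\Rightarrow b))\&(d\Rightarrow(b\Rightarrow c)))\Rightarrow(d\Rightarrow(a\Rightarrow c))$; A3 $((c\Rightarrow a)\&(c\Rightarrow b))\Rightarrow(c\Rightarrow(a\&b))$; A4 $(a\&b)\Rightarrow a$, $(a\&b)\Rightarrow b$; A5 $a\Rightarrow(a\cap b)$, $b\Rightarrow(a\cap b)$; A6 $((a\Rightarrow c)\&(b\Rightarrow c))\Rightarrow((a\cap b)\Rightarrow c)$; A7 $a\Rightarrow a$; A8 $a\Rightarrow\varnothing$; A9 $\bot\Rightarrow a$; A10 $(\varnothing\Rightarrow a)\Rightarrow((\varnothing\Rightarrow b)\Rightarrow(a\&b))$; A11 $(a\Rightarrow b)\Rightarrow(\varnothing\Rightarrow(a\Rightarrow b))$; A12 $(((a\Rightarrow b)\Rightarrow\bot)\Rightarrow\bot)\Rightarrow(a\Rightarrow b)$; A13 (schema) $a\in\{x\mid\alpha\}=(\mathrm{Sing}(a)\&\alpha[x:=a])$; A14a $a\Rightarrow\{x\mid x\in a\}$; A14b $(V\Rightarrow a)\Rightarrow(\{x\mid x\in a\}\Rightarrow a)$. *)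

theory Defs
  imports Main
begin

text \<open>
  Expressions are represented in locally nameless style: forming the class of all \<open>x\<close> such
  that \<open>\<beta>\<close> turns the free appearances of the variable \<open>x\<close> in \<open>\<beta>\<close> into a bound (de Bruijn)
  index.  The constructor \<open>Bnd\<close> is not available on its own: the objects of the system are
  the raw expressions satisfying \<open>is_obj\<close> below, which have no dangling indices.

  Any object may serve as the name \<open>\<alpha>\<close> of a variable \<open>Var \<alpha>\<close>.  Variables are atomic: a
  variable appearing in the name of another one does not count as an appearance, and
  substitution and binding do not act inside names.
\<close>

datatype expr =
    Empty  (\<open>\<^bold>\<emptyset>\<close>)
  | Cst expr
  | Var expr
  | And expr expr  (infixr \<open>\<^bold>&\<close> 65)
  | Imp expr expr  (infixr \<open>\<^bold>\<Rightarrow>\<close> 45)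
  | Cap expr expr  (infixr \<open>\<^bold>\<inter>\<close> 70)
  | Cls expr
  | Bnd nat

primrec close_at :: "nat \<Rightarrow> expr \<Rightarrow> expr \<Rightarrow> expr" where
  "close_at k x \<^bold>\<emptyset> = \<^bold>\<emptyset>"
| "close_at k x (Cst \<alpha>) = Cst (close_at k x \<alpha>)"
| "close_at k x (Var \<alpha>) = (if Var \<alpha> = x then Bnd k else Var \<alpha>)"
| "close_at k x (\<alpha> \<^bold>& \<beta>) = (close_at k x \<alpha> \<^bold>& close_at k x \<beta>)"
| "close_at k x (\<alpha> \<^bold>\<Rightarrow> \<beta>) = (close_at k x \<alpha> \<^bold>\<Rightarrow> close_at k x \<beta>)"
| "close_at k x (\<alpha> \<^bold>\<inter> \<beta>) = (close_at k x \<alpha> \<^bold>\<inter> close_at k x \<beta>)"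
| "close_at k x (Cls \<alpha>) = Cls (close_at (Suc k) x \<alpha>)"
| "close_at k x (Bnd i) = Bnd i"

definition Class :: "expr \<Rightarrow> expr \<Rightarrow> expr"  (\<open>\<lbrace>_ \<bar> _\<rbrace>\<close>) where
  "\<lbrace>x \<bar> \<beta>\<rbrace> = Cls (close_at 0 x \<beta>)"

inductive is_obj :: "expr \<Rightarrow> bool" where
  "is_obj \<^bold>\<emptyset>"
| "is_obj \<alpha> \<Longrightarrow> is_obj (Cst \<alpha>)"
| "is_obj \<alpha> \<Longrightarrow> is_obj (Var \<alpha>)"
| "is_obj \<alpha> \<Longrightarrow> is_obj \<beta> \<Longrightarrow> is_obj (\<alpha> \<^bold>& \<beta>)"
| "is_obj \<alpha> \<Longrightarrow> is_obj \<beta> \<Longrightarrow> is_obj (\<alpha> \<^bold>\<Rightarrow> \<beta>)"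
| "is_obj \<alpha> \<Longrightarrow> is_obj \<beta> \<Longrightarrow> is_obj (\<alpha> \<^bold>\<inter> \<beta>)"
| "is_obj \<alpha> \<Longrightarrow> is_obj \<beta> \<Longrightarrow> is_obj \<lbrace>Var \<alpha> \<bar> \<beta>\<rbrace>"

definition is_var :: "expr \<Rightarrow> bool" where
  "is_var x \<longleftrightarrow> (\<exists>\<alpha>. is_obj \<alpha> \<and> x = Var \<alpha>)"

definition is_formula :: "expr \<Rightarrow> bool" where
  "is_formula \<phi> \<longleftrightarrow> (\<exists>\<alpha> \<beta>. is_obj \<alpha> \<and> is_obj \<beta> \<and> \<phi> = (\<alpha> \<^bold>\<Rightarrow> \<beta>))"

primrec appears :: "expr \<Rightarrow> expr \<Rightarrow> bool" where
  "appears x \<^bold>\<emptyset> \<longleftrightarrow> False"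
| "appears x (Cst \<alpha>) \<longleftrightarrow> appears x \<alpha>"
| "appears x (Var \<alpha>) \<longleftrightarrow> Var \<alpha> = x"
| "appears x (\<alpha> \<^bold>& \<beta>) \<longleftrightarrow> appears x \<alpha> \<or> appears x \<beta>"
| "appears x (\<alpha> \<^bold>\<Rightarrow> \<beta>) \<longleftrightarrow> appears x \<alpha> \<or> appears x \<beta>"
| "appears x (\<alpha> \<^bold>\<inter> \<beta>) \<longleftrightarrow> appears x \<alpha> \<or> appears x \<beta>"
| "appears x (Cls \<alpha>) \<longleftrightarrow> appears x \<alpha>"
| "appears x (Bnd i) \<longleftrightarrow> False"

text \<open>
  Only objects are ever substituted; as these have no dangling indices, no shifting is needed
  below \<open>Cls\<close>, and no variable can be captured.
\<close>

primrec subst :: "expr \<Rightarrow> expr \<Rightarrow> expr \<Rightarrow> expr"  (\<open>_[_ ::= _]\<close> [1000, 0, 0] 1000) where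
  "\<^bold>\<emptyset>[x ::= \<gamma>] = \<^bold>\<emptyset>"
| "(Cst \<alpha>)[x ::= \<gamma>] = Cst (\<alpha>[x ::= \<gamma>])"
| "(Var \<alpha>)[x ::= \<gamma>] = (if Var \<alpha> = x then \<gamma> else Var \<alpha>)"
| "(\<alpha> \<^bold>& \<beta>)[x ::= \<gamma>] = (\<alpha>[x ::= \<gamma>] \<^bold>& \<beta>[x ::= \<gamma>])"
| "(\<alpha> \<^bold>\<Rightarrow> \<beta>)[x ::= \<gamma>] = (\<alpha>[x ::= \<gamma>] \<^bold>\<Rightarrow> \<beta>[x ::= \<gamma>])"
| "(\<alpha> \<^bold>\<inter> \<beta>)[x ::= \<gamma>] = (\<alpha>[x ::= \<gamma>] \<^bold>\<inter> \<beta>[x ::= \<gamma>])"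
| "(Cls \<alpha>)[x ::= \<gamma>] = Cls (\<alpha>[x ::= \<gamma>])"
| "(Bnd i)[x ::= \<gamma>] = Bnd i"

abbreviation Bot :: expr  (\<open>\<^bold>\<bottom>\<close>) where
  "\<^bold>\<bottom> \<equiv> Cst \<^bold>\<emptyset>"

abbreviation Neg :: "expr \<Rightarrow> expr"  (\<open>\<^bold>\<not> _\<close> [80] 80) where
  "\<^bold>\<not> a \<equiv> (a \<^bold>\<Rightarrow> \<^bold>\<bottom>)"

abbreviation Bar :: "expr \<Rightarrow> expr" where
  "Bar a \<equiv> (\<^bold>\<emptyset> \<^bold>\<Rightarrow> a)"

abbreviation Or :: "expr \<Rightarrow> expr \<Rightarrow> expr"  (infixr \<open>\<^bold>\<or>\<close> 60) where
  "a \<^bold>\<or> b \<equiv> Bar (Bar a \<^bold>\<inter> Bar b)"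

abbreviation Eq :: "expr \<Rightarrow> expr \<Rightarrow> expr"  (infix \<open>\<^bold>=\<close> 50) where
  "a \<^bold>= b \<equiv> (a \<^bold>\<Rightarrow> b) \<^bold>& (b \<^bold>\<Rightarrow> a)"

abbreviation Neq :: "expr \<Rightarrow> expr \<Rightarrow> expr"  (infix \<open>\<^bold>\<noteq>\<close> 50) where
  "a \<^bold>\<noteq> b \<equiv> \<^bold>\<not> (a \<^bold>= b)"

text \<open>
  Being a singleton, and hence membership, is stated by means of an auxiliary variable \<open>b\<close>,
  which stays free in the object; it is an explicit parameter here.
\<close>

abbreviation Sing :: "expr \<Rightarrow> expr \<Rightarrow> expr" where
  "Sing b a \<equiv> (Bar a \<^bold>\<noteq> a) \<^bold>& ((a \<^bold>\<Rightarrow> b) \<^bold>\<Rightarrow> (Bar b \<^bold>\<or> (a \<^bold>= b)))"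

abbreviation Mem :: "expr \<Rightarrow> expr \<Rightarrow> expr \<Rightarrow> expr" where
  "Mem b a c \<equiv> Sing b a \<^bold>& (c \<^bold>\<Rightarrow> a)"

text \<open>The choice of the bound variable is irrelevant: \<open>\<lbrace>x \<bar> \<^bold>\<emptyset>\<rbrace>\<close> is the same object for all \<open>x\<close>.\<close>

abbreviation Univ :: expr where
  "Univ \<equiv> \<lbrace>Var \<^bold>\<emptyset> \<bar> \<^bold>\<emptyset>\<rbrace>"

lemma Class_Empty_eq_Univ: "\<lbrace>x \<bar> \<^bold>\<emptyset>\<rbrace> = Univ"
  by (simp add: Class_def)

text \<open>
  The axioms are stated for all choices of pairwise distinct variables \<open>a\<close>, \<open>b\<close>, \<open>c\<close>, \<open>d\<close>,
  \<open>x\<close>; in \<open>A13\<close>, \<open>A14a\<close> and \<open>A14b\<close> the variable \<open>b\<close> is the auxiliary one of \<open>Sing\<close>.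
\<close>

definition axiom_vars :: "expr list \<Rightarrow> bool" where
  "axiom_vars xs \<longleftrightarrow> distinct xs \<and> (\<forall>x\<in>set xs. is_var x)"

inductive derivable :: "expr \<Rightarrow> bool"  (\<open>\<turnstile> _\<close> [40] 40) where
  R1: "\<turnstile> \<alpha> \<Longrightarrow> \<turnstile> (\<alpha> \<^bold>\<Rightarrow> \<beta>) \<Longrightarrow> \<turnstile> \<beta>"
| R2: "\<turnstile> \<alpha> \<Longrightarrow> is_var x \<Longrightarrow> is_obj \<beta> \<Longrightarrow> \<turnstile> \<alpha>[x ::= \<beta>]"
| R3: "\<turnstile> (\<gamma> \<^bold>\<Rightarrow> (\<alpha> \<^bold>\<Rightarrow> \<beta>)) \<Longrightarrow> is_var x \<Longrightarrow> \<not> appears x \<gamma> \<Longrightarrow>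
       \<turnstile> (\<gamma> \<^bold>\<Rightarrow> (\<lbrace>x \<bar> \<beta>\<rbrace> \<^bold>\<Rightarrow> \<lbrace>x \<bar> \<alpha>\<rbrace>))"
| A1: "axiom_vars [a, b, c] \<Longrightarrow>
       \<turnstile> (((c \<^bold>\<Rightarrow> a) \<^bold>& (c \<^bold>\<Rightarrow> (a \<^bold>\<Rightarrow> b))) \<^bold>\<Rightarrow> (c \<^bold>\<Rightarrow> b))"
| A2: "axiom_vars [a, b, c, d] \<Longrightarrow>
       \<turnstile> (((d \<^bold>\<Rightarrow> (a \<^bold>\<Rightarrow> b)) \<^bold>& (d \<^bold>\<Rightarrow> (b \<^bold>\<Rightarrow> c))) \<^bold>\<Rightarrow> (d \<^bold>\<Rightarrow> (a \<^bold>\<Rightarrow> c)))"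
| A3: "axiom_vars [a, b, c] \<Longrightarrow>
       \<turnstile> (((c \<^bold>\<Rightarrow> a) \<^bold>& (c \<^bold>\<Rightarrow> b)) \<^bold>\<Rightarrow> (c \<^bold>\<Rightarrow> (a \<^bold>& b)))"
| A4_left: "axiom_vars [a, b] \<Longrightarrow> \<turnstile> ((a \<^bold>& b) \<^bold>\<Rightarrow> a)"
| A4_right: "axiom_vars [a, b] \<Longrightarrow> \<turnstile> ((a \<^bold>& b) \<^bold>\<Rightarrow> b)"
| A5_left: "axiom_vars [a, b] \<Longrightarrow> \<turnstile> (a \<^bold>\<Rightarrow> (a \<^bold>\<inter> b))"
| A5_right: "axiom_vars [a, b] \<Longrightarrow> \<turnstile> (b \<^bold>\<Rightarrow> (a \<^bold>\<inter> b))"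
| A6: "axiom_vars [a, b, c] \<Longrightarrow>
       \<turnstile> (((a \<^bold>\<Rightarrow> c) \<^bold>& (b \<^bold>\<Rightarrow> c)) \<^bold>\<Rightarrow> ((a \<^bold>\<inter> b) \<^bold>\<Rightarrow> c))"
| A7: "axiom_vars [a] \<Longrightarrow> \<turnstile> (a \<^bold>\<Rightarrow> a)"
| A8: "axiom_vars [a] \<Longrightarrow> \<turnstile> (a \<^bold>\<Rightarrow> \<^bold>\<emptyset>)"
| A9: "axiom_vars [a] \<Longrightarrow> \<turnstile> (\<^bold>\<bottom> \<^bold>\<Rightarrow> a)"
| A10: "axiom_vars [a, b] \<Longrightarrow>
       \<turnstile> ((\<^bold>\<emptyset> \<^bold>\<Rightarrow> a) \<^bold>\<Rightarrow> ((\<^bold>\<emptyset> \<^bold>\<Rightarrow> b) \<^bold>\<Rightarrow> (a \<^bold>& b)))"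
| A11: "axiom_vars [a, b] \<Longrightarrow> \<turnstile> ((a \<^bold>\<Rightarrow> b) \<^bold>\<Rightarrow> (\<^bold>\<emptyset> \<^bold>\<Rightarrow> (a \<^bold>\<Rightarrow> b)))"
| A12: "axiom_vars [a, b] \<Longrightarrow> \<turnstile> ((((a \<^bold>\<Rightarrow> b) \<^bold>\<Rightarrow> \<^bold>\<bottom>) \<^bold>\<Rightarrow> \<^bold>\<bottom>) \<^bold>\<Rightarrow> (a \<^bold>\<Rightarrow> b))"
| A13: "axiom_vars [a, b, x] \<Longrightarrow> is_obj \<alpha> \<Longrightarrow>
       \<turnstile> (Mem b a \<lbrace>x \<bar> \<alpha>\<rbrace> \<^bold>= (Sing b a \<^bold>& \<alpha>[x ::= a]))"
| A14a: "axiom_vars [a, b, x] \<Longrightarrow> \<turnstile> (a \<^bold>\<Rightarrow> \<lbrace>x \<bar> Mem b x a\<rbrace>)"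
| A14b: "axiom_vars [a, b, x] \<Longrightarrow>
       \<turnstile> ((Univ \<^bold>\<Rightarrow> a) \<^bold>\<Rightarrow> (\<lbrace>x \<bar> Mem b x a\<rbrace> \<^bold>\<Rightarrow> a))"

end

theory Submission
  imports Defs
begin

text \<open>
  Writing \<open>S\<close> for \<open>Sing b x\<close>, axiom A13 identifies \<open>x \<in> \<lbrace>x \<bar> \<phi>\<rbrace>\<close> with \<open>S \<^bold>& \<phi>\<close>, and A14 says
  that \<open>C\<close> contains \<open>\<lbrace>x \<bar> x \<in> C\<rbrace>\<close>, and is contained in it as soon as \<open>V\<close> contains \<open>C\<close>.
  Since R3 makes class formation antitone in the order \<open>\<^bold>\<Rightarrow>\<close>, each equation reduces to comparing
  the condition \<open>x \<in> C\<close> with the one defining the other side.  Only disjunction elimination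
  under the assumption \<open>S\<close> needs \<open>\<phi>\<close> and \<open>\<psi>\<close> to be formulas: A11 yields the deduction rule
  from \<open>(s \<^bold>& a) \<^bold>\<Rightarrow> c\<close> to \<open>a \<^bold>\<Rightarrow> (s \<^bold>\<Rightarrow> c)\<close> just for formulas \<open>a\<close>.
\<close>

\<comment> \<open>Objects, appearance and substitution\<close>
inductive_simps is_obj_simps [simp]:
  "is_obj (Cst \<alpha>)" "is_obj (Var \<alpha>)" "is_obj (\<alpha> \<^bold>& \<beta>)" "is_obj (\<alpha> \<^bold>\<Rightarrow> \<beta>)" "is_obj (\<alpha> \<^bold>\<inter> \<beta>)"

declare is_obj.intros(1) [simp]

lemma is_obj_Cls [simp]: "is_var x \<Longrightarrow> is_obj \<beta> \<Longrightarrow> is_obj \<lbrace>x \<bar> \<beta>\<rbrace>"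
  by (auto simp: is_var_def intro: is_obj.intros)

lemma is_obj_var: "is_var x \<Longrightarrow> is_obj x"
  by (auto simp: is_var_def)

lemma is_var_Var [simp]: "is_var (Var \<alpha>) \<longleftrightarrow> is_obj \<alpha>"
  by (simp add: is_var_def)

lemma subst_fresh [simp]: "\<not> appears x \<alpha> \<Longrightarrow> \<alpha>[x ::= \<gamma>] = \<alpha>"
  by (induction \<alpha>) auto

lemma close_at_fresh [simp]: "\<not> appears x \<alpha> \<Longrightarrow> close_at k x \<alpha> = \<alpha>"
  by (induction \<alpha> arbitrary: k) auto

lemma appears_close_at: "appears y (close_at k x \<alpha>) \<longleftrightarrow> y \<noteq> x \<and> appears y \<alpha>"
  by (induction \<alpha> arbitrary: k) auto

lemma appears_Class [simp]: "appears y \<lbrace>x \<bar> \<alpha>\<rbrace> \<longleftrightarrow> y \<noteq> x \<and> appears y \<alpha>"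
  by (simp add: Class_def appears_close_at)

lemma close_at_subst:
  "x \<noteq> y \<Longrightarrow> \<not> appears x \<gamma> \<Longrightarrow> (close_at k x \<alpha>)[y ::= \<gamma>] = close_at k x (\<alpha>[y ::= \<gamma>])"
  by (induction \<alpha> arbitrary: k) auto

text \<open>On the right the binder closes after the substitution, so it would bind an
  \<open>x\<close> appearing in \<open>\<gamma>\<close> that stays free on the left; the second
  condition excludes this.\<close>

lemma Class_subst:
  "x \<noteq> y \<Longrightarrow> \<not> appears x \<gamma> \<Longrightarrow> \<lbrace>x \<bar> \<alpha>\<rbrace>[y ::= \<gamma>] = \<lbrace>x \<bar> \<alpha>[y ::= \<gamma>]\<rbrace>"
  by (simp add: Class_def close_at_subst)

text \<open>Lets an axiom stated for a fresh variable be specialised to \<open>x\<close> itself: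
  every \<open>Var a\<close> in the substituted expression stems from \<open>x\<close>.\<close>

lemma subst_rename_back:
  "\<not> appears (Var a) \<alpha> \<Longrightarrow> \<alpha>[x ::= Var a][Var a ::= x] = \<alpha>"
  by (induction \<alpha>) auto

section \<open>Fresh variables and instances of the axioms\<close>

lemma finite_appears: "finite {v. appears (Var v) \<alpha>}"
  by (induction \<alpha>) auto

text \<open>Objects name variables, so this makes the supply of variables infinite. The iterates of
  \<open>Cst\<close> on the constant are already pairwise distinct.\<close>

lemma infinite_objects: "infinite {v. is_obj v}"
proof -
  have "inj (\<lambda>n. (Cst ^^ n) \<^bold>\<emptyset>)"
  proof (rule injI)
    show "m = n" if "(Cst ^^ m) \<^bold>\<emptyset> = (Cst ^^ n) \<^bold>\<emptyset>" for m n
      using that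
    proof (induction m arbitrary: n)
      case 0
      then show ?case by (cases n) auto
    next
      case (Suc m)
      then show ?case by (cases n) auto
    qed
  qed
  moreover have "is_obj ((Cst ^^ n) \<^bold>\<emptyset>)" for n
    by (induction n) auto
  ultimately show ?thesis
    unfolding infinite_iff_countable_subset by (intro exI conjI) auto
qed

lemma obtain_fresh:
  assumes "finite F"
  obtains v where "is_obj v" "\<forall>\<alpha>\<in>F. \<not> appears (Var v) \<alpha>"
proof -
  have "finite (\<Union>\<alpha>\<in>F. {v. appears (Var v) \<alpha>})"
    using assms by (simp add: finite_appears)
  then have "infinite ({v. is_obj v} - (\<Union>\<alpha>\<in>F. {v. appears (Var v) \<alpha>}))"
    using infinite_objects by (rule Diff_infinite_finite)
  then obtain v where "v \<in> {v. is_obj v} - (\<Union>\<alpha>\<in>F. {v. appears (Var v) \<alpha>})"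
    using infinite_imp_nonempty by blast
  then show ?thesis using that by auto
qed

text \<open>A2 has four variables, the most among the axioms instantiated through
  \<open>derivable_instance\<close>.\<close>

lemma obtain_fresh4:
  assumes "finite F"
  obtains p q r s where
    "is_obj p" "is_obj q" "is_obj r" "is_obj s" "distinct [p, q, r, s]"
    "\<forall>\<alpha>\<in>F. \<not> appears (Var p) \<alpha> \<and> \<not> appears (Var q) \<alpha> \<and> \<not> appears (Var r) \<alpha> \<and> \<not> appears (Var s) \<alpha>"
proof -
  obtain p where p: "is_obj p" "\<forall>\<alpha>\<in>F. \<not> appears (Var p) \<alpha>"
    using obtain_fresh[OF assms] by blast
  obtain q where q: "is_obj q" "\<forall>\<alpha>\<in>F \<union> {Var p}. \<not> appears (Var q) \<alpha>"
    using obtain_fresh[of "F \<union> {Var p}"] assms by blast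
  obtain r where r: "is_obj r" "\<forall>\<alpha>\<in>F \<union> {Var p, Var q}. \<not> appears (Var r) \<alpha>"
    using obtain_fresh[of "F \<union> {Var p, Var q}"] assms by blast
  obtain s where s: "is_obj s" "\<forall>\<alpha>\<in>F \<union> {Var p, Var q, Var r}. \<not> appears (Var s) \<alpha>"
    using obtain_fresh[of "F \<union> {Var p, Var q, Var r}"] assms by blast
  show ?thesis
    by (rule that[of p q r s]) (use p q r s in auto)
qed

text \<open>
  Substituting for variables that are fresh for all the instances turns the one-variable rule
  R2 into simultaneous substitution.
\<close>

lemma derivable_instance:
  assumes "\<And>p q r s. \<lbrakk>is_obj p; is_obj q; is_obj r; is_obj s; distinct [p, q, r, s];
      \<forall>\<xi>\<in>{\<alpha>, \<beta>, \<gamma>, \<delta>}. \<not> appears (Var p) \<xi> \<and> \<not> appears (Var q) \<xi> \<and>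
        \<not> appears (Var r) \<xi> \<and> \<not> appears (Var s) \<xi>\<rbrakk> \<Longrightarrow>
      \<exists>\<theta>. \<turnstile> \<theta> \<and> \<theta>[Var p ::= \<alpha>][Var q ::= \<beta>][Var r ::= \<gamma>][Var s ::= \<delta>] = \<chi>"
    and "is_obj \<alpha>" "is_obj \<beta>" "is_obj \<gamma>" "is_obj \<delta>"
  shows "\<turnstile> \<chi>"
proof -
  obtain p q r s where *: "is_obj p" "is_obj q" "is_obj r" "is_obj s" "distinct [p, q, r, s]"
      "\<forall>\<xi>\<in>{\<alpha>, \<beta>, \<gamma>, \<delta>}. \<not> appears (Var p) \<xi> \<and> \<not> appears (Var q) \<xi> \<and>
        \<not> appears (Var r) \<xi> \<and> \<not> appears (Var s) \<xi>"
    by (rule obtain_fresh4[of "{\<alpha>, \<beta>, \<gamma>, \<delta>}"]) auto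
  then obtain \<theta> where "\<turnstile> \<theta>" "\<theta>[Var p ::= \<alpha>][Var q ::= \<beta>][Var r ::= \<gamma>][Var s ::= \<delta>] = \<chi>"
    using assms(1) by blast
  then show ?thesis
    using R2 * assms(2-) by (metis is_var_Var)
qed

lemma A1_inst:
  assumes "is_obj a" "is_obj b" "is_obj c"
  shows "\<turnstile> (((c \<^bold>\<Rightarrow> a) \<^bold>& (c \<^bold>\<Rightarrow> (a \<^bold>\<Rightarrow> b))) \<^bold>\<Rightarrow> (c \<^bold>\<Rightarrow> b))"
\<comment> \<open>A1 has three variables, so the fourth slot repeats \<open>c\<close>: the last
  substitution concerns a variable absent from the expression by then and changes nothing. Other
  axioms with fewer than four variables are padded likewise.\<close>
proof (rule derivable_instance[of a b c c], goal_cases)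
  case (1 p q r s)
  then show ?case
    by - (rule exI, rule conjI, rule A1[of "Var p" "Var q" "Var r"], auto simp: axiom_vars_def)
qed (use assms in auto)

lemma A2_inst:
  assumes "is_obj a" "is_obj b" "is_obj c" "is_obj d"
  shows "\<turnstile> (((d \<^bold>\<Rightarrow> (a \<^bold>\<Rightarrow> b)) \<^bold>& (d \<^bold>\<Rightarrow> (b \<^bold>\<Rightarrow> c))) \<^bold>\<Rightarrow> (d \<^bold>\<Rightarrow> (a \<^bold>\<Rightarrow> c)))"
proof (rule derivable_instance[of a b c d], goal_cases)
  case (1 p q r s)
  then show ?case
    by - (rule exI, rule conjI, rule A2[of "Var p" "Var q" "Var r" "Var s"], auto simp: axiom_vars_def)
qed (use assms in auto)

lemma A3_inst:
  assumes "is_obj a" "is_obj b" "is_obj c"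
  shows "\<turnstile> (((c \<^bold>\<Rightarrow> a) \<^bold>& (c \<^bold>\<Rightarrow> b)) \<^bold>\<Rightarrow> (c \<^bold>\<Rightarrow> (a \<^bold>& b)))"
proof (rule derivable_instance[of a b c c], goal_cases)
  case (1 p q r s)
  then show ?case
    by - (rule exI, rule conjI, rule A3[of "Var p" "Var q" "Var r"], auto simp: axiom_vars_def)
qed (use assms in auto)

lemma A4_inst:
  assumes "is_obj a" "is_obj b"
  shows "\<turnstile> ((a \<^bold>& b) \<^bold>\<Rightarrow> a)" and "\<turnstile> ((a \<^bold>& b) \<^bold>\<Rightarrow> b)"
proof -
  show "\<turnstile> ((a \<^bold>& b) \<^bold>\<Rightarrow> a)"
  proof (rule derivable_instance[of a b a a], goal_cases)
    case (1 p q r s)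
    then show ?case
      by - (rule exI, rule conjI, rule A4_left[of "Var p" "Var q"], auto simp: axiom_vars_def)
  qed (use assms in auto)
  show "\<turnstile> ((a \<^bold>& b) \<^bold>\<Rightarrow> b)"
  proof (rule derivable_instance[of a b a a], goal_cases)
    case (1 p q r s)
    then show ?case
      by - (rule exI, rule conjI, rule A4_right[of "Var p" "Var q"], auto simp: axiom_vars_def)
  qed (use assms in auto)
qed

lemma A5_inst:
  assumes "is_obj a" "is_obj b"
  shows "\<turnstile> (a \<^bold>\<Rightarrow> (a \<^bold>\<inter> b))" and "\<turnstile> (b \<^bold>\<Rightarrow> (a \<^bold>\<inter> b))"
proof -
  show "\<turnstile> (a \<^bold>\<Rightarrow> (a \<^bold>\<inter> b))"
  proof (rule derivable_instance[of a b a a], goal_cases)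
    case (1 p q r s)
    then show ?case
      by - (rule exI, rule conjI, rule A5_left[of "Var p" "Var q"], auto simp: axiom_vars_def)
  qed (use assms in auto)
  show "\<turnstile> (b \<^bold>\<Rightarrow> (a \<^bold>\<inter> b))"
  proof (rule derivable_instance[of a b a a], goal_cases)
    case (1 p q r s)
    then show ?case
      by - (rule exI, rule conjI, rule A5_right[of "Var p" "Var q"], auto simp: axiom_vars_def)
  qed (use assms in auto)
qed

lemma A6_inst:
  assumes "is_obj a" "is_obj b" "is_obj c"
  shows "\<turnstile> (((a \<^bold>\<Rightarrow> c) \<^bold>& (b \<^bold>\<Rightarrow> c)) \<^bold>\<Rightarrow> ((a \<^bold>\<inter> b) \<^bold>\<Rightarrow> c))"
proof (rule derivable_instance[of a b c c], goal_cases)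
  case (1 p q r s)
  then show ?case
    by - (rule exI, rule conjI, rule A6[of "Var p" "Var q" "Var r"], auto simp: axiom_vars_def)
qed (use assms in auto)

lemma A7_inst:
  assumes "is_obj a"
  shows "\<turnstile> (a \<^bold>\<Rightarrow> a)"
proof (rule derivable_instance[of a a a a], goal_cases)
  case (1 p q r s)
  then show ?case
    by - (rule exI, rule conjI, rule A7[of "Var p"], auto simp: axiom_vars_def)
qed (use assms in auto)

lemma A8_inst:
  assumes "is_obj a"
  shows "\<turnstile> (a \<^bold>\<Rightarrow> \<^bold>\<emptyset>)"
proof (rule derivable_instance[of a a a a], goal_cases)
  case (1 p q r s)
  then show ?case
    by - (rule exI, rule conjI, rule A8[of "Var p"], auto simp: axiom_vars_def)
qed (use assms in auto)

lemma A10_inst: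
  assumes "is_obj a" "is_obj b"
  shows "\<turnstile> (Bar a \<^bold>\<Rightarrow> (Bar b \<^bold>\<Rightarrow> (a \<^bold>& b)))"
proof (rule derivable_instance[of a b a a], goal_cases)
  case (1 p q r s)
  then show ?case
    by - (rule exI, rule conjI, rule A10[of "Var p" "Var q"], auto simp: axiom_vars_def)
qed (use assms in auto)

lemma A11_inst:
  assumes "is_obj a" "is_obj b"
  shows "\<turnstile> ((a \<^bold>\<Rightarrow> b) \<^bold>\<Rightarrow> Bar (a \<^bold>\<Rightarrow> b))"
proof (rule derivable_instance[of a b a a], goal_cases)
  case (1 p q r s)
  then show ?case
    by - (rule exI, rule conjI, rule A11[of "Var p" "Var q"], auto simp: axiom_vars_def)
qed (use assms in auto)

section \<open>Derived propositional rules\<close>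

lemma derivable_Empty: "\<turnstile> \<^bold>\<emptyset>"
  \<comment> \<open>By A8 any derivable object yields the constant. It can then be discharged as a
    trivial antecedent.\<close>
  using A7_inst[of "\<^bold>\<emptyset>"] A8_inst[of "\<^bold>\<emptyset> \<^bold>\<Rightarrow> \<^bold>\<emptyset>"] by (auto intro: R1)

lemma derivable_Bar:
  assumes "\<turnstile> (a \<^bold>\<Rightarrow> b)" "is_obj a" "is_obj b"
  shows "\<turnstile> Bar (a \<^bold>\<Rightarrow> b)"
  using assms A11_inst by (blast intro: R1)

text \<open>A10 asks for both conjuncts under \<open>Bar\<close>, which A11 supplies for
  implications; hence the shape of the conjuncts.\<close>

lemma derivable_And:
  assumes "\<turnstile> (a \<^bold>\<Rightarrow> b)" "\<turnstile> (c \<^bold>\<Rightarrow> d)" "is_obj a" "is_obj b" "is_obj c" "is_obj d"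
  shows "\<turnstile> ((a \<^bold>\<Rightarrow> b) \<^bold>& (c \<^bold>\<Rightarrow> d))"
proof -
  have "\<turnstile> (Bar (a \<^bold>\<Rightarrow> b) \<^bold>\<Rightarrow> (Bar (c \<^bold>\<Rightarrow> d) \<^bold>\<Rightarrow> ((a \<^bold>\<Rightarrow> b) \<^bold>& (c \<^bold>\<Rightarrow> d))))"
    using assms by (intro A10_inst) auto
  then show ?thesis
    using assms derivable_Bar R1 by blast
qed

lemma derivable_mp_under:
  assumes "\<turnstile> (c \<^bold>\<Rightarrow> a)" "\<turnstile> (c \<^bold>\<Rightarrow> (a \<^bold>\<Rightarrow> b))" "is_obj a" "is_obj b" "is_obj c"
  shows "\<turnstile> (c \<^bold>\<Rightarrow> b)"
  by (rule R1[OF derivable_And A1_inst]) (use assms in auto)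

lemma derivable_trans_under:
  assumes "\<turnstile> (d \<^bold>\<Rightarrow> (a \<^bold>\<Rightarrow> b))" "\<turnstile> (d \<^bold>\<Rightarrow> (b \<^bold>\<Rightarrow> c))"
    and "is_obj a" "is_obj b" "is_obj c" "is_obj d"
  shows "\<turnstile> (d \<^bold>\<Rightarrow> (a \<^bold>\<Rightarrow> c))"
  by (rule R1[OF derivable_And A2_inst[of a b c d]]) (use assms in auto)

text \<open>A2 under the trivial assumption \<emptyset>, which is discharged afterwards.\<close>

lemma derivable_trans:
  assumes "\<turnstile> (a \<^bold>\<Rightarrow> b)" "\<turnstile> (b \<^bold>\<Rightarrow> c)" "is_obj a" "is_obj b" "is_obj c"
  shows "\<turnstile> (a \<^bold>\<Rightarrow> c)"
  by (rule R1[OF derivable_Empty derivable_trans_under[of "\<^bold>\<emptyset>" a b c]])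
    (use assms in \<open>auto intro: derivable_Bar\<close>)

lemma derivable_pair:
  assumes "\<turnstile> (c \<^bold>\<Rightarrow> a)" "\<turnstile> (c \<^bold>\<Rightarrow> b)" "is_obj a" "is_obj b" "is_obj c"
  shows "\<turnstile> (c \<^bold>\<Rightarrow> (a \<^bold>& b))"
  by (rule R1[OF derivable_And A3_inst]) (use assms in auto)

lemma derivable_Cap_elim:
  assumes "\<turnstile> (a \<^bold>\<Rightarrow> c)" "\<turnstile> (b \<^bold>\<Rightarrow> c)" "is_obj a" "is_obj b" "is_obj c"
  shows "\<turnstile> ((a \<^bold>\<inter> b) \<^bold>\<Rightarrow> c)"
  by (rule R1[OF derivable_And A6_inst]) (use assms in auto)

lemma derivable_weaken:
  assumes "\<turnstile> (a \<^bold>\<Rightarrow> b)" "is_obj a" "is_obj b" "is_obj c"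
  shows "\<turnstile> (c \<^bold>\<Rightarrow> (a \<^bold>\<Rightarrow> b))"
  by (rule derivable_trans[OF A8_inst derivable_Bar]) (use assms in auto)

text \<open>Modus ponens under the assumption \<open>Bar a\<close>: A8 provides the antecedent
  \<emptyset>, A7 the implication from it to \<open>a\<close>.\<close>

lemma derivable_Bar_elim: "is_obj a \<Longrightarrow> \<turnstile> (Bar a \<^bold>\<Rightarrow> a)"
  by (rule derivable_mp_under[OF A8_inst A7_inst]) auto

lemma derivable_Bar_mono:
  assumes "\<turnstile> (a \<^bold>\<Rightarrow> b)" "is_obj a" "is_obj b"
  shows "\<turnstile> (Bar a \<^bold>\<Rightarrow> Bar b)"
  by (rule derivable_trans_under[OF A7_inst derivable_weaken]) (use assms in auto)

lemma derivable_uncurry: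
  assumes "\<turnstile> (a \<^bold>\<Rightarrow> (s \<^bold>\<Rightarrow> c))" "is_obj a" "is_obj s" "is_obj c"
  shows "\<turnstile> ((s \<^bold>& a) \<^bold>\<Rightarrow> c)"
  by (rule derivable_mp_under[OF A4_inst(1) derivable_trans[OF A4_inst(2)]])
    (use assms in auto)

text \<open>Under the assumption \<open>a\<close>, A8 and A11 give the chain from \<open>s\<close>
  over \<emptyset> to \<open>a\<close>. Pairing it with the identity on \<open>s\<close> by A3 leads
  from \<open>s\<close> to the conjunction, and from there to \<open>c\<close>.\<close>

lemma derivable_curry:
  assumes "\<turnstile> ((s \<^bold>& a) \<^bold>\<Rightarrow> c)" "is_formula a" "is_obj s" "is_obj c"
  shows "\<turnstile> (a \<^bold>\<Rightarrow> (s \<^bold>\<Rightarrow> c))"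
proof -
  obtain p q where a: "is_obj p" "is_obj q" "a = (p \<^bold>\<Rightarrow> q)"
    using assms(2) by (auto simp: is_formula_def)
  have obj: "is_obj a"
    by (simp add: a)
  have "\<turnstile> (a \<^bold>\<Rightarrow> (s \<^bold>\<Rightarrow> \<^bold>\<emptyset>))"
    using obj assms by (intro derivable_weaken A8_inst) auto
  moreover have "\<turnstile> (a \<^bold>\<Rightarrow> (\<^bold>\<emptyset> \<^bold>\<Rightarrow> a))"
    using A11_inst a by simp
  ultimately have "\<turnstile> (a \<^bold>\<Rightarrow> (s \<^bold>\<Rightarrow> a))"
    by (rule derivable_trans_under) (use obj assms in auto)
  moreover have "\<turnstile> (a \<^bold>\<Rightarrow> (s \<^bold>\<Rightarrow> s))"
    using obj assms by (intro derivable_weaken A7_inst) auto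
  ultimately have "\<turnstile> (a \<^bold>\<Rightarrow> ((s \<^bold>\<Rightarrow> s) \<^bold>& (s \<^bold>\<Rightarrow> a)))"
    using obj assms by (intro derivable_pair) auto
  then have "\<turnstile> (a \<^bold>\<Rightarrow> (s \<^bold>\<Rightarrow> (s \<^bold>& a)))"
    by (rule derivable_trans[OF _ A3_inst]) (use obj assms in auto)
  moreover have "\<turnstile> (a \<^bold>\<Rightarrow> ((s \<^bold>& a) \<^bold>\<Rightarrow> c))"
    using obj assms by (intro derivable_weaken) auto
  ultimately show ?thesis
    by (rule derivable_trans_under) (use obj assms in auto)
qed

text \<open>The disjunction puts one \<open>Bar\<close> on each disjunct and one around the
  intersection. A11 applied twice creates both, and A5 acts under the outer one by
  monotonicity.\<close>

lemma derivable_Or_intro1: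
  assumes "is_formula \<phi>" "is_obj \<psi>"
  shows "\<turnstile> (\<phi> \<^bold>\<Rightarrow> (\<phi> \<^bold>\<or> \<psi>))"
proof -
  obtain p q where \<phi>: "is_obj p" "is_obj q" "\<phi> = (p \<^bold>\<Rightarrow> q)"
    using assms by (auto simp: is_formula_def)
  have "\<turnstile> (\<phi> \<^bold>\<Rightarrow> Bar (Bar \<phi>))"
    by (rule derivable_trans[of _ "Bar \<phi>"]) (use \<phi> in \<open>auto intro: A11_inst\<close>)
  then show ?thesis
    by (rule derivable_trans[OF _ derivable_Bar_mono[OF A5_inst(1)]]) (use \<phi> assms in auto)
qed

lemma derivable_Or_intro2:
  assumes "is_formula \<psi>" "is_obj \<phi>"
  shows "\<turnstile> (\<psi> \<^bold>\<Rightarrow> (\<phi> \<^bold>\<or> \<psi>))"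
proof -
  obtain p q where \<psi>: "is_obj p" "is_obj q" "\<psi> = (p \<^bold>\<Rightarrow> q)"
    using assms by (auto simp: is_formula_def)
  have "\<turnstile> (\<psi> \<^bold>\<Rightarrow> Bar (Bar \<psi>))"
    by (rule derivable_trans[of _ "Bar \<psi>"]) (use \<psi> in \<open>auto intro: A11_inst\<close>)
  then show ?thesis
    by (rule derivable_trans[OF _ derivable_Bar_mono[OF A5_inst(2)]]) (use \<psi> assms in auto)
qed

text \<open>Both layers of \<open>Bar\<close> can be stripped from arbitrary objects, which leaves
  the intersection to A6.\<close>

lemma derivable_Or_elim:
  assumes "\<turnstile> (\<phi> \<^bold>\<Rightarrow> \<chi>)" "\<turnstile> (\<psi> \<^bold>\<Rightarrow> \<chi>)" "is_obj \<phi>" "is_obj \<psi>" "is_obj \<chi>"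
  shows "\<turnstile> ((\<phi> \<^bold>\<or> \<psi>) \<^bold>\<Rightarrow> \<chi>)"
proof -
  have "\<turnstile> ((Bar \<phi> \<^bold>\<inter> Bar \<psi>) \<^bold>\<Rightarrow> \<chi>)"
    by (intro derivable_Cap_elim derivable_trans[OF derivable_Bar_elim]) (use assms in auto)
  then show ?thesis
    by (rule derivable_trans[OF derivable_Bar_elim, rotated]) (use assms in auto)
qed

section \<open>Classes and membership\<close>

lemma Class_antimono:
  assumes "\<turnstile> (\<alpha> \<^bold>\<Rightarrow> \<beta>)" "is_var x" "is_obj \<alpha>" "is_obj \<beta>"
  shows "\<turnstile> (\<lbrace>x \<bar> \<beta>\<rbrace> \<^bold>\<Rightarrow> \<lbrace>x \<bar> \<alpha>\<rbrace>)"
  \<comment> \<open>R3 is used with \<emptyset> as its context, in which no variable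
    appears.\<close>
  by (rule R1[OF derivable_Empty R3]) (use assms in \<open>auto intro: derivable_Bar\<close>)

text \<open>\<open>Univ\<close> is the class of \<emptyset>, which everything implies, so
  antitonicity applies. This supplies the premise of A14b.\<close>

lemma Univ_contains_Class:
  assumes "is_var x" "is_obj \<phi>"
  shows "\<turnstile> (Univ \<^bold>\<Rightarrow> \<lbrace>x \<bar> \<phi>\<rbrace>)"
  using Class_antimono[OF A8_inst, of \<phi> x] assms by (simp add: Class_Empty_eq_Univ[of x])

text \<open>A13 keeps the element variable apart from the bound one. It is taken at a fresh
  variable, which R2 then replaces by \<open>x\<close>; the class itself is untouched.\<close>

lemma A13_inst:
  assumes "is_var x" "is_var b" "b \<noteq> x" "is_obj \<phi>"
  shows "\<turnstile> (Mem b x \<lbrace>x \<bar> \<phi>\<rbrace> \<^bold>= (Sing b x \<^bold>& \<phi>))"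
proof -
  obtain a where a: "is_obj a" "\<forall>\<alpha>\<in>{x, b, \<phi>}. \<not> appears (Var a) \<alpha>"
    by (rule obtain_fresh[of "{x, b, \<phi>}"]) auto
  obtain y c where yc: "x = Var y" "b = Var c"
    using assms by (auto simp: is_var_def)
  have "\<turnstile> (Mem b (Var a) \<lbrace>x \<bar> \<phi>\<rbrace> \<^bold>= (Sing b (Var a) \<^bold>& \<phi>[x ::= Var a]))"
    using a assms yc by (intro A13) (auto simp: axiom_vars_def)
  from R2[OF this, of "Var a" x] show ?thesis
    using a assms yc by (simp add: subst_rename_back)
qed

lemma Mem_Class_elim:
  assumes "is_var x" "is_var b" "b \<noteq> x" "is_obj \<phi>"
  shows "\<turnstile> (Mem b x \<lbrace>x \<bar> \<phi>\<rbrace> \<^bold>\<Rightarrow> (Sing b x \<^bold>& \<phi>))"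
  by (rule R1[OF A13_inst[OF assms] A4_inst(1)]) (use assms in \<open>auto simp: is_obj_var\<close>)

lemma Mem_Class_intro:
  assumes "is_var x" "is_var b" "b \<noteq> x" "is_obj \<phi>"
  shows "\<turnstile> ((Sing b x \<^bold>& \<phi>) \<^bold>\<Rightarrow> Mem b x \<lbrace>x \<bar> \<phi>\<rbrace>)"
  by (rule R1[OF A13_inst[OF assms] A4_inst(2)]) (use assms in \<open>auto simp: is_obj_var\<close>)

text \<open>The axiom at a fresh variable, followed by R2. As \<open>x\<close> does not appear in
  \<open>C\<close>, the substitution passes under the binder.\<close>

lemma A14a_inst:
  assumes "is_var x" "is_var b" "b \<noteq> x" "is_obj C" "\<not> appears x C"
  shows "\<turnstile> (C \<^bold>\<Rightarrow> \<lbrace>x \<bar> Mem b x C\<rbrace>)"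
proof -
  obtain a where a: "is_obj a" "\<forall>\<alpha>\<in>{x, b}. \<not> appears (Var a) \<alpha>"
    by (rule obtain_fresh[of "{x, b}"]) auto
  obtain y c where yc: "x = Var y" "b = Var c"
    using assms by (auto simp: is_var_def)
  have "\<turnstile> (Var a \<^bold>\<Rightarrow> \<lbrace>x \<bar> Mem b x (Var a)\<rbrace>)"
    using a assms yc by (intro A14a) (auto simp: axiom_vars_def)
  from R2[OF this, of "Var a" C] show ?thesis
    using a assms yc by (simp add: Class_subst)
qed

lemma A14b_rule:
  assumes "\<turnstile> (Univ \<^bold>\<Rightarrow> C)" "is_var x" "is_var b" "b \<noteq> x" "is_obj C" "\<not> appears x C"
  shows "\<turnstile> (\<lbrace>x \<bar> Mem b x C\<rbrace> \<^bold>\<Rightarrow> C)"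
proof -
  obtain a where a: "is_obj a" "\<forall>\<alpha>\<in>{x, b}. \<not> appears (Var a) \<alpha>"
    by (rule obtain_fresh[of "{x, b}"]) auto
  obtain y c where yc: "x = Var y" "b = Var c"
    using assms by (auto simp: is_var_def)
  have "\<turnstile> ((Univ \<^bold>\<Rightarrow> Var a) \<^bold>\<Rightarrow> (\<lbrace>x \<bar> Mem b x (Var a)\<rbrace> \<^bold>\<Rightarrow> Var a))"
    using a assms yc by (intro A14b) (auto simp: axiom_vars_def)
  from R2[OF this, of "Var a" C] have "\<turnstile> ((Univ \<^bold>\<Rightarrow> C) \<^bold>\<Rightarrow> (\<lbrace>x \<bar> Mem b x C\<rbrace> \<^bold>\<Rightarrow> C))"
    using a assms yc by (simp add: Class_subst)
  with assms(1) show ?thesis by (rule R1)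
qed

text \<open>By A13 and antitonicity the left side implies the class of all \<open>x\<close>
  belonging to the right side, and A14b leads back from there.\<close>

lemma Class_Sing_absorb:
  assumes "is_var x" "is_var b" "b \<noteq> x" "is_obj \<phi>"
  shows "\<turnstile> (\<lbrace>x \<bar> Sing b x \<^bold>& \<phi>\<rbrace> \<^bold>\<Rightarrow> \<lbrace>x \<bar> \<phi>\<rbrace>)"
  by (rule derivable_trans[OF Class_antimono[OF Mem_Class_elim]
        A14b_rule[OF Univ_contains_Class]])
    (use assms in \<open>auto simp: is_obj_var\<close>)

section \<open>The four inclusions and the two equations\<close>

lemma Class_Or_contains_And:
  assumes \<phi>: "is_formula \<phi>" and \<psi>: "is_formula \<psi>" and x: "is_var x"
  shows "\<turnstile> (\<lbrace>x \<bar> \<phi> \<^bold>\<or> \<psi>\<rbrace> \<^bold>\<Rightarrow> (\<lbrace>x \<bar> \<phi>\<rbrace> \<^bold>& \<lbrace>x \<bar> \<psi>\<rbrace>))"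
proof -
  have "is_obj \<phi>" "is_obj \<psi>"
    using \<phi> \<psi> by (auto simp: is_formula_def)
  then show ?thesis
    using assms
    by (intro derivable_pair Class_antimono derivable_Or_intro1 derivable_Or_intro2) auto
qed

text \<open>With \<open>C\<close> the conjunction of the classes, A14a leads to the class of all
  \<open>x\<close> in \<open>C\<close>. It remains to show that \<open>Sing b x\<close> together
  with the disjunction yields membership in \<open>C\<close>; the extra \<open>Sing b x\<close> is
  finally absorbed.\<close>

lemma And_contains_Class_Or:
  assumes \<phi>: "is_formula \<phi>" and \<psi>: "is_formula \<psi>" and x: "is_var x"
  shows "\<turnstile> ((\<lbrace>x \<bar> \<phi>\<rbrace> \<^bold>& \<lbrace>x \<bar> \<psi>\<rbrace>) \<^bold>\<Rightarrow> \<lbrace>x \<bar> \<phi> \<^bold>\<or> \<psi>\<rbrace>)"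
proof -
  have obj: "is_obj \<phi>" "is_obj \<psi>" "is_obj x"
    using \<phi> \<psi> x by (auto simp: is_formula_def is_obj_var)
  \<comment> \<open>The claim does not mention the auxiliary variable of \<open>Sing\<close>, so any
    variable other than \<open>x\<close>, as A13 and A14 demand, may be taken; it may even appear in
    \<open>\<phi>\<close> or \<open>\<psi>\<close>.\<close>
  obtain v where v: "is_obj v" "\<forall>\<alpha>\<in>{x}. \<not> appears (Var v) \<alpha>"
    by (rule obtain_fresh[of "{x}"]) auto
  define b where "b = Var v"
  have b: "is_var b" "b \<noteq> x" "is_obj b"
    using v by (auto simp: b_def)
  let ?C = "\<lbrace>x \<bar> \<phi>\<rbrace> \<^bold>& \<lbrace>x \<bar> \<psi>\<rbrace>"
  let ?S = "Sing b x"
  \<comment> \<open>Currying moves \<open>?S\<close> behind \<open>\<theta>\<close>, so that each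
    disjunct stands alone as antecedent, ready for disjunction elimination.\<close>
  have mem: "\<turnstile> (\<theta> \<^bold>\<Rightarrow> (?S \<^bold>\<Rightarrow> (?C \<^bold>\<Rightarrow> x)))"
    if "is_formula \<theta>" "is_obj \<theta>" "\<turnstile> (?C \<^bold>\<Rightarrow> \<lbrace>x \<bar> \<theta>\<rbrace>)" for \<theta>
  proof (rule derivable_curry)
    have "\<turnstile> ((?S \<^bold>& \<theta>) \<^bold>\<Rightarrow> (?C \<^bold>\<Rightarrow> \<lbrace>x \<bar> \<theta>\<rbrace>))"
      by (rule derivable_weaken) (use obj b x that in auto)
    \<comment> \<open>By A13, \<open>?S\<close> and \<open>\<theta>\<close> make \<open>x\<close> a
      member of the class of \<open>\<theta>\<close>; the second half of membership is the
      implication from the class to \<open>x\<close>.\<close>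
    moreover have "\<turnstile> ((?S \<^bold>& \<theta>) \<^bold>\<Rightarrow> (\<lbrace>x \<bar> \<theta>\<rbrace> \<^bold>\<Rightarrow> x))"
      by (rule derivable_trans[OF Mem_Class_intro A4_inst(2)]) (use obj b x that in auto)
    ultimately show "\<turnstile> ((?S \<^bold>& \<theta>) \<^bold>\<Rightarrow> (?C \<^bold>\<Rightarrow> x))"
      by (rule derivable_trans_under) (use obj b x that in auto)
  qed (use obj b x that in auto)
  have "\<turnstile> ((\<phi> \<^bold>\<or> \<psi>) \<^bold>\<Rightarrow> (?S \<^bold>\<Rightarrow> (?C \<^bold>\<Rightarrow> x)))"
    by (rule derivable_Or_elim[OF mem[OF _ _ A4_inst(1)] mem[OF _ _ A4_inst(2)]])
      (use obj b x \<phi> \<psi> in auto)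
  then have "\<turnstile> ((?S \<^bold>& (\<phi> \<^bold>\<or> \<psi>)) \<^bold>\<Rightarrow> (?C \<^bold>\<Rightarrow> x))"
    by (rule derivable_uncurry) (use obj b x in auto)
  then have "\<turnstile> ((?S \<^bold>& (\<phi> \<^bold>\<or> \<psi>)) \<^bold>\<Rightarrow> Mem b x ?C)"
    by (intro derivable_pair A4_inst(1)) (use obj b x in auto)
  then have "\<turnstile> (\<lbrace>x \<bar> Mem b x ?C\<rbrace> \<^bold>\<Rightarrow> \<lbrace>x \<bar> ?S \<^bold>& (\<phi> \<^bold>\<or> \<psi>)\<rbrace>)"
    by (rule Class_antimono) (use obj b x in auto)
  with A14a_inst have "\<turnstile> (?C \<^bold>\<Rightarrow> \<lbrace>x \<bar> ?S \<^bold>& (\<phi> \<^bold>\<or> \<psi>)\<rbrace>)"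
    by (rule derivable_trans) (use obj b x in auto)
  then show ?thesis
    by (rule derivable_trans[OF _ Class_Sing_absorb]) (use obj b x in auto)
qed

lemma Cap_contains_Class_And:
  assumes "is_obj \<phi>" "is_obj \<psi>" "is_var x"
  shows "\<turnstile> ((\<lbrace>x \<bar> \<phi>\<rbrace> \<^bold>\<inter> \<lbrace>x \<bar> \<psi>\<rbrace>) \<^bold>\<Rightarrow> \<lbrace>x \<bar> \<phi> \<^bold>& \<psi>\<rbrace>)"
  using assms by (intro derivable_Cap_elim Class_antimono A4_inst) auto

text \<open>By A5 each class implies the intersection, so a member of the intersection is a member
  of each class and satisfies both conditions by A13. Antitonicity and A14b then finish.\<close>

lemma Class_And_contains_Cap:
  assumes "is_obj \<phi>" "is_obj \<psi>" and x: "is_var x"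
  shows "\<turnstile> (\<lbrace>x \<bar> \<phi> \<^bold>& \<psi>\<rbrace> \<^bold>\<Rightarrow> (\<lbrace>x \<bar> \<phi>\<rbrace> \<^bold>\<inter> \<lbrace>x \<bar> \<psi>\<rbrace>))"
proof -
  have obj: "is_obj \<phi>" "is_obj \<psi>" "is_obj x"
    using assms by (auto simp: is_obj_var)
  obtain v where v: "is_obj v" "\<forall>\<alpha>\<in>{x}. \<not> appears (Var v) \<alpha>"
    by (rule obtain_fresh[of "{x}"]) auto
  define b where "b = Var v"
  have b: "is_var b" "b \<noteq> x" "is_obj b"
    using v by (auto simp: b_def)
  let ?C = "\<lbrace>x \<bar> \<phi>\<rbrace> \<^bold>\<inter> \<lbrace>x \<bar> \<psi>\<rbrace>"
  have mem: "\<turnstile> (Mem b x ?C \<^bold>\<Rightarrow> \<theta>)" if "is_obj \<theta>" "\<turnstile> (\<lbrace>x \<bar> \<theta>\<rbrace> \<^bold>\<Rightarrow> ?C)" for \<theta>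
  proof -
    have "\<turnstile> (Mem b x ?C \<^bold>\<Rightarrow> (\<lbrace>x \<bar> \<theta>\<rbrace> \<^bold>\<Rightarrow> ?C))"
      by (rule derivable_weaken) (use obj b x that in auto)
    then have "\<turnstile> (Mem b x ?C \<^bold>\<Rightarrow> (\<lbrace>x \<bar> \<theta>\<rbrace> \<^bold>\<Rightarrow> x))"
      by (rule derivable_trans_under[OF _ A4_inst(2)]) (use obj b x that in auto)
    then have "\<turnstile> (Mem b x ?C \<^bold>\<Rightarrow> Mem b x \<lbrace>x \<bar> \<theta>\<rbrace>)"
      by (intro derivable_pair A4_inst(1)) (use obj b x that in auto)
    then have "\<turnstile> (Mem b x ?C \<^bold>\<Rightarrow> (Sing b x \<^bold>& \<theta>))"
      by (rule derivable_trans[OF _ Mem_Class_elim]) (use obj b x that in auto)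
    then show ?thesis
      by (rule derivable_trans[OF _ A4_inst(2)]) (use obj b x that in auto)
  qed
  have "\<turnstile> (Mem b x ?C \<^bold>\<Rightarrow> (\<phi> \<^bold>& \<psi>))"
    by (intro derivable_pair mem A5_inst) (use obj b x in auto)
  then have "\<turnstile> (\<lbrace>x \<bar> \<phi> \<^bold>& \<psi>\<rbrace> \<^bold>\<Rightarrow> \<lbrace>x \<bar> Mem b x ?C\<rbrace>)"
    by (rule Class_antimono) (use obj b x in auto)
  \<comment> \<open>The premise of A14b: \<open>Univ\<close> implies the first class, which implies
    the intersection.\<close>
  moreover have "\<turnstile> (Univ \<^bold>\<Rightarrow> ?C)"
    by (rule derivable_trans[OF Univ_contains_Class A5_inst(1)]) (use obj x in auto)
  then have "\<turnstile> (\<lbrace>x \<bar> Mem b x ?C\<rbrace> \<^bold>\<Rightarrow> ?C)"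
    by (rule A14b_rule) (use obj b x in auto)
  ultimately show ?thesis
    by (rule derivable_trans) (use obj b x in auto)
qed

theorem theorem3p15:
  fixes \<phi> \<psi> x :: expr
  assumes "is_formula \<phi>" and "is_formula \<psi>" and "is_var x"
  shows "\<turnstile> (\<lbrace>x \<bar> \<phi> \<^bold>\<or> \<psi>\<rbrace> \<^bold>= (\<lbrace>x \<bar> \<phi>\<rbrace> \<^bold>& \<lbrace>x \<bar> \<psi>\<rbrace>)) \<and>
         \<turnstile> (\<lbrace>x \<bar> \<phi> \<^bold>& \<psi>\<rbrace> \<^bold>= (\<lbrace>x \<bar> \<phi>\<rbrace> \<^bold>\<inter> \<lbrace>x \<bar> \<psi>\<rbrace>))"
proof -
  have "is_obj \<phi>" "is_obj \<psi>"
    using assms by (auto simp: is_formula_def)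
  with assms show ?thesis
    by (intro conjI derivable_And Class_Or_contains_And And_contains_Class_Or
        Class_And_contains_Cap Cap_contains_Class_And) auto
qed

end
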